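(* Let $(X,\mathscr{T},\le)$ be a compact preordered space. Let $\phi:[0,+\infty)\to[0,+\infty)$ be a non-decreasing continuous function such that $\phi(x)\le x$ for all $x\ge 0$, with equality if and only if $x=0$ or $x=1$. Let $S\subset C^+(X,\le,\mathbb{R})$ be non-empty and such that (i) $S$ is a convex cone: $S+S\subset S$ and $\lambda S\subset S$ for every $\lambda>0$; (ii) if $f\in S$ then $\phi(f):=\phi\circ f\in S$; (iii) $S$ generates $\le$, that is, $\le\,=\,\le_S$. Then $\bar S=C^+(X,\le,\mathbb{R},N_S)$. In particular, if additionally (iv) $N_S=\emptyset$, that is, for every $x\in X$ there is some $f\in S$ such that $f(x)>0$ (this follows if $S$ contains the constant function $1$), then $\bar S=C^+(X,\le,\mathbb{R})$.
   Context: A preorder is a reflexive and transitive relation. A compact preordered space is a triple $(X,\mathscr{T},\le)$ where $(X,\mathscr{T})$ is a compact topological space (not assumed Hausdorff) and $\le$ is a preorder on $X$ whose graph $\{(x,y): x\le y\}$ is closed in $X\times X$ with the product topology. A function $f:X\to\mathbb{R}$ is isotone if $x\le y$ implies $f(x)\le f(y)$. $C(X,\mathbb{R})$ is the set of continuous real functions on $X$ with the uniform (sup) norm. $C^+(X,\le,\mathbb{R})$ is the set of non-negative continuous isotone functions $X\to\mathbb{R}$; for $N\subset X$, $C^+(X,\le,\mathbb{R},N)$ is the set of those that vanish on $N$. For $S\subset C(X,\mathbb{R})$: $\bar S$ is the closure of $S$ in the uniform norm; $N_S=\{x\in X: f(x)=0\ \forall f\in S\}$; and $\le_S=\{(x,y)\in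 X^2: f(x)\le f(y)\ \forall f\in S\}$. *)

theory Defs
  imports "HOL-Analysis.Analysis"
begin

definition compact_preordered_space :: "'a topology \<Rightarrow> 'a rel \<Rightarrow> bool" where
  "compact_preordered_space X r \<longleftrightarrow>
     compact_space X \<and> preorder_on (topspace X) r \<and> closedin (prod_topology X X) r"

text \<open>
  Functions on the space \<open>X\<close> are extensional: they are \<^const>\<open>undefined\<close> outside
  \<open>topspace X\<close>. Therefore pointwise operations on them are restricted to \<open>topspace X\<close>.
  The metric of \<^const>\<open>cfunspace\<close> is the supremum metric; its built-in boundedness
  requirement is no restriction when \<open>X\<close> is compact.
\<close>

abbreviation C_metric :: "'a topology \<Rightarrow> ('a \<Rightarrow> real) metric" where
  "C_metric X \<equiv> cfunspace X euclidean_metric"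

abbreviation C_space :: "'a topology \<Rightarrow> ('a \<Rightarrow> real) set" where
  "C_space X \<equiv> mspace (C_metric X)"

abbreviation uniform_closure :: "'a topology \<Rightarrow> ('a \<Rightarrow> real) set \<Rightarrow> ('a \<Rightarrow> real) set" where
  "uniform_closure X S \<equiv> mtopology_of (C_metric X) closure_of S"

definition isotone :: "'a rel \<Rightarrow> ('a \<Rightarrow> real) \<Rightarrow> bool" where
  "isotone r f \<longleftrightarrow> (\<forall>(x, y) \<in> r. f x \<le> f y)"

definition C_plus :: "'a topology \<Rightarrow> 'a rel \<Rightarrow> ('a \<Rightarrow> real) set" where
  "C_plus X r = {f \<in> C_space X. (\<forall>x \<in> topspace X. 0 \<le> f x) \<and> isotone r f}"

definition C_plus_vanishing :: "'a topology \<Rightarrow> 'a rel \<Rightarrow> 'a set \<Rightarrow> ('a \<Rightarrow> real) set" where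
  "C_plus_vanishing X r N = {f \<in> C_plus X r. \<forall>x \<in> N. f x = 0}"

definition zero_locus :: "'a topology \<Rightarrow> ('a \<Rightarrow> real) set \<Rightarrow> 'a set" where
  "zero_locus X S = {x \<in> topspace X. \<forall>f \<in> S. f x = 0}"

definition generated_preorder :: "'a topology \<Rightarrow> ('a \<Rightarrow> real) set \<Rightarrow> 'a rel" where
  "generated_preorder X S = {(x, y) \<in> topspace X \<times> topspace X. \<forall>f \<in> S. f x \<le> f y}"

definition convex_cone_on :: "'a topology \<Rightarrow> ('a \<Rightarrow> real) set \<Rightarrow> bool" where
  "convex_cone_on X S \<longleftrightarrow>
     (\<forall>f \<in> S. \<forall>g \<in> S. (\<lambda>x \<in> topspace X. f x + g x) \<in> S) \<and>
     (\<forall>c > 0. \<forall>f \<in> S. (\<lambda>x \<in> topspace X. c * f x) \<in> S)"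

end

theory Submission
  imports Defs
begin

text \<open>
  The iterates of \<open>\<phi>\<close> converge to \<open>0\<close> on \<open>[0, 1)\<close> and to \<open>1\<close> on \<open>[1, \<infinity>)\<close>, uniformly on sets
  that are bounded and bounded away from \<open>1\<close> from below. Applied to a rescaled element of \<open>S\<close>
  they turn a function that is \<open>\<ge> 1\<close> on \<open>B\<close> and \<open>\<le> q < 1\<close> on \<open>A\<close> into an almost-indicator of
  \<open>B\<close> against \<open>A\<close>. Such a separation survives finite unions on either side: for \<open>A\<close> one
  averages, for \<open>B\<close> one adds, and one iterates \<open>\<phi>\<close> again. Since \<open>S\<close> generates the preorder,
  compactness separates \<open>{g \<le> a}\<close> from \<open>{g \<ge> b}\<close> for every isotone \<open>g\<close> vanishing on the zero
  locus and \<open>0 \<le> a < b\<close>. Finally \<open>g\<close> is a uniform limit of layer sums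
  \<open>\<epsilon> (h\<^sub>1 + \<dots> + h\<^sub>n)\<close>, where \<open>h\<^sub>k\<close> separates \<open>{g \<le> (k - 1) \<epsilon>}\<close> from \<open>{g \<ge> k \<epsilon>}\<close>.
\<close>

text \<open>The open sets satisfying \<open>P\<close> cover \<open>K\<close>; \<open>P\<close>
  passes to the union of a finite subcover and then down to \<open>K\<close>. In this form a
  compactness argument in two variables becomes two nested inductions.\<close>

lemma compactin_induct [consumes 1, case_names local empty Un subset]:
  assumes "compactin X K"
    and local: "\<And>x. x \<in> K \<Longrightarrow> \<exists>U. openin X U \<and> x \<in> U \<and> P U"
    and empty: "P {}"
    and Un: "\<And>A B. P A \<Longrightarrow> P B \<Longrightarrow> P (A \<union> B)"
    and subset: "\<And>A B. P A \<Longrightarrow> B \<subseteq> A \<Longrightarrow> P B"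
  shows "P K"
proof -
  have "K \<subseteq> \<Union>{U. openin X U \<and> P U}"
    using local by blast
  moreover have "\<forall>U\<in>{U. openin X U \<and> P U}. openin X U"
    by blast
  ultimately obtain F
    where F: "finite F" "F \<subseteq> {U. openin X U \<and> P U}" "K \<subseteq> \<Union>F"
    using \<open>compactin X K\<close>[unfolded compactin_def] by meson
  from F(1,2) have "P (\<Union>F)"
    by (induction rule: finite_induct) (auto intro: empty Un)
  with F(3) show ?thesis
    using subset by blast
qed

section \<open>Iteration of the map \<phi>\<close>

locale contracting_map =
  fixes \<phi> :: "real \<Rightarrow> real"
  assumes nonneg: "0 \<le> t \<Longrightarrow> 0 \<le> \<phi> t"
    and mono: "mono_on {0..} \<phi>"
    and cont: "continuous_on {0..} \<phi>"
    and le: "0 \<le> t \<Longrightarrow> \<phi> t \<le> t"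
    and fixpoint_iff: "0 \<le> t \<Longrightarrow> \<phi> t = t \<longleftrightarrow> t = 0 \<or> t = 1"
begin

lemma funpow_nonneg: "0 \<le> t \<Longrightarrow> 0 \<le> (\<phi> ^^ n) t"
  by (induction n) (auto intro: nonneg)

lemma funpow_mono: "0 \<le> s \<Longrightarrow> s \<le> t \<Longrightarrow> (\<phi> ^^ n) s \<le> (\<phi> ^^ n) t"
proof (induction n)
  case (Suc n)
  then show ?case
    using mono_onD[OF mono] funpow_nonneg[of s n] funpow_nonneg[of t n] by auto
qed simp

lemma funpow_fixpoint: "t = 0 \<or> t = 1 \<Longrightarrow> (\<phi> ^^ n) t = t"
  using fixpoint_iff[of t] by (induction n) auto

lemma funpow_antimono:
  assumes "0 \<le> t"
  shows "decseq (\<lambda>n. (\<phi> ^^ n) t)"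
  using le funpow_nonneg[OF assms] by (auto simp: decseq_Suc_iff)

text \<open>The iterates decrease and stay nonnegative, hence converge, and continuity of \<phi>
  makes the limit a fixpoint. The bound \<open>L \<le> t\<close> excludes \<open>L = 1\<close> when
  \<open>t < 1\<close>; for \<open>1 \<le> t\<close>, monotonicity keeps the iterates above the
  fixpoint 1, which excludes 0.\<close>

lemma funpow_tendsto_fixpoint:
  assumes "0 \<le> t"
  obtains L where "(\<lambda>n. (\<phi> ^^ n) t) \<longlonglongrightarrow> L" "L = 0 \<or> L = 1" "L \<le> t"
proof -
  obtain L where L: "(\<lambda>n. (\<phi> ^^ n) t) \<longlonglongrightarrow> L" and "\<forall>n. L \<le> (\<phi> ^^ n) t"
    using decseq_convergent[OF funpow_antimono] funpow_nonneg assms by metis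
  then have "L \<le> t"
    by (metis funpow_0)
  have "0 \<le> L"
    using LIMSEQ_le_const[OF L] funpow_nonneg[OF assms] by blast
  have "(\<lambda>n. \<phi> ((\<phi> ^^ n) t)) \<longlonglongrightarrow> \<phi> L"
    using continuous_on_tendsto_compose[OF cont L] \<open>0 \<le> L\<close> funpow_nonneg[OF assms] by simp
  moreover have "(\<lambda>n. \<phi> ((\<phi> ^^ n) t)) \<longlonglongrightarrow> L"
    using LIMSEQ_Suc[OF L] by simp
  ultimately have "\<phi> L = L"
    by (rule LIMSEQ_unique)
  then show thesis
    using that L \<open>0 \<le> L\<close> \<open>L \<le> t\<close> fixpoint_iff by blast
qed

lemma funpow_tendsto_0: "0 \<le> t \<Longrightarrow> t < 1 \<Longrightarrow> (\<lambda>n. (\<phi> ^^ n) t) \<longlonglongrightarrow> 0"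
  by (rule funpow_tendsto_fixpoint[of t]) auto

lemma funpow_ge_1: "1 \<le> t \<Longrightarrow> 1 \<le> (\<phi> ^^ n) t"
  using funpow_mono[of 1 t n] funpow_fixpoint[of 1 n] by simp

lemma funpow_tendsto_1:
  assumes "1 \<le> t"
  shows "(\<lambda>n. (\<phi> ^^ n) t) \<longlonglongrightarrow> 1"
proof (rule funpow_tendsto_fixpoint[of t])
  fix L assume L: "(\<lambda>n. (\<phi> ^^ n) t) \<longlonglongrightarrow> L" "L = 0 \<or> L = 1"
  have "1 \<le> L"
    using LIMSEQ_le_const[OF L(1)] funpow_ge_1[OF assms] by blast
  with L show ?thesis
    by auto
qed (use assms in auto)

end

section \<open>Separation of sets by elements of the cone\<close>

locale contracted_cone = contracting_map +
  fixes X :: "'a topology" and T :: "('a \<Rightarrow> real) set"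
  assumes compact: "compact_space X"
    and continuous: "f \<in> T \<Longrightarrow> continuous_map X euclideanreal f"
    and T_nonneg: "f \<in> T \<Longrightarrow> x \<in> topspace X \<Longrightarrow> 0 \<le> f x"
    and T_nonempty: "T \<noteq> {}"
    and T_add: "f \<in> T \<Longrightarrow> g \<in> T \<Longrightarrow> (\<lambda>x. f x + g x) \<in> T"
    and T_scale: "0 < c \<Longrightarrow> f \<in> T \<Longrightarrow> (\<lambda>x. c * f x) \<in> T"
    and T_contract: "f \<in> T \<Longrightarrow> (\<lambda>x. \<phi> (f x)) \<in> T"
begin

lemma T_funpow: "f \<in> T \<Longrightarrow> (\<lambda>x. (\<phi> ^^ n) (f x)) \<in> T"
  by (induction n) (auto dest: T_contract)

lemma bounded_above:
  assumes "continuous_map X euclideanreal f"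
  obtains M where "0 < M" "\<And>x. x \<in> topspace X \<Longrightarrow> f x \<le> M"
proof -
  have "compactin euclideanreal (f ` topspace X)"
    using image_compactin compact assms unfolding compact_space_def by blast
  then have "bounded (f ` topspace X)"
    by (simp add: compact_imp_bounded)
  then obtain M where "0 < M" "\<forall>x\<in>topspace X. \<bar>f x\<bar> \<le> M"
    by (auto simp: bounded_pos)
  then show thesis
    using that[of M] by force
qed

text \<open>The asymmetry comes from \<phi>: its iterates need not reach 0 or 1, but they never take
  a value of at least 1 below 1. So the bound on \<open>B\<close> is exact, whereas those on
  \<open>A\<close> and on the whole space have an error \<delta>. The global bound keeps averages
  small on \<open>A\<close> and later limits the height of each layer.\<close>

definition separated :: "'a set \<Rightarrow> 'a set \<Rightarrow> bool" where
  "separated A B \<longleftrightarrow> (\<forall>\<delta>>0. \<exists>h\<in>T. (\<forall>x\<in>A \<inter> topspace X. h x \<le> \<delta>) \<and>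
     (\<forall>x\<in>B \<inter> topspace X. 1 \<le> h x) \<and> (\<forall>x\<in>topspace X. h x \<le> 1 + \<delta>))"

lemma separatedD:
  assumes "separated A B" "0 < \<delta>"
  obtains h where "h \<in> T" "\<And>x. x \<in> A \<Longrightarrow> x \<in> topspace X \<Longrightarrow> h x \<le> \<delta>"
    "\<And>x. x \<in> B \<Longrightarrow> x \<in> topspace X \<Longrightarrow> 1 \<le> h x" "\<And>x. x \<in> topspace X \<Longrightarrow> h x \<le> 1 + \<delta>"
proof -
  obtain h where "h \<in> T" "\<forall>x\<in>A \<inter> topspace X. h x \<le> \<delta>"
    "\<forall>x\<in>B \<inter> topspace X. 1 \<le> h x" "\<forall>x\<in>topspace X. h x \<le> 1 + \<delta>"
    using assms unfolding separated_def by auto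
  then show thesis
    by (intro that[of h]) auto
qed

lemma separated_mono: "separated A B \<Longrightarrow> A' \<subseteq> A \<Longrightarrow> B' \<subseteq> B \<Longrightarrow> separated A' B'"
proof -
  assume sep: "separated A B" and sub: "A' \<subseteq> A" "B' \<subseteq> B"
  show "separated A' B'"
    unfolding separated_def
  proof (intro allI impI)
    fix \<delta> :: real assume "0 < \<delta>"
    with sep show "\<exists>h\<in>T. (\<forall>x\<in>A' \<inter> topspace X. h x \<le> \<delta>) \<and>
       (\<forall>x\<in>B' \<inter> topspace X. 1 \<le> h x) \<and> (\<forall>x\<in>topspace X. h x \<le> 1 + \<delta>)"
      by (rule separatedD) (use sub in blast)
  qed
qed

text \<open>A single gap below 1 yields every \<delta>: iterating \<phi> pushes values up to
  \<open>q\<close> towards 0 and values above 1 towards 1. By monotonicity, convergence at two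
  endpoints already controls all values uniformly.\<close>

lemma separatedI:
  assumes "f \<in> T" "q < 1" "\<And>x. x \<in> A \<Longrightarrow> x \<in> topspace X \<Longrightarrow> f x \<le> q"
    "\<And>x. x \<in> B \<Longrightarrow> x \<in> topspace X \<Longrightarrow> 1 \<le> f x"
  shows "separated A B"
  unfolding separated_def
proof (intro allI impI)
  fix \<delta> :: real assume "0 < \<delta>"
  obtain M where M: "\<And>x. x \<in> topspace X \<Longrightarrow> f x \<le> M"
    using bounded_above continuous \<open>f \<in> T\<close> by metis
  \<comment> \<open>The maxima, here and below, meet the hypotheses of the limit lemmas:
    \<open>q\<close> may be negative and \<open>M\<close> may lie below 1.\<close>
  have "\<forall>\<^sub>F n in sequentially. (\<phi> ^^ n) (max 0 q) < \<delta>"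
    using order_tendstoD(2)[OF funpow_tendsto_0] \<open>0 < \<delta>\<close> \<open>q < 1\<close> by simp
  moreover have "\<forall>\<^sub>F n in sequentially. (\<phi> ^^ n) (max 1 M) < 1 + \<delta>"
    using order_tendstoD(2)[OF funpow_tendsto_1] \<open>0 < \<delta>\<close> by simp
  ultimately have "\<forall>\<^sub>F n in sequentially. (\<phi> ^^ n) (max 0 q) < \<delta> \<and> (\<phi> ^^ n) (max 1 M) < 1 + \<delta>"
    by (rule eventually_conj)
  then obtain n where n: "(\<phi> ^^ n) (max 0 q) < \<delta>" "(\<phi> ^^ n) (max 1 M) < 1 + \<delta>"
    by (auto dest: eventually_happens)
  show "\<exists>h\<in>T. (\<forall>x\<in>A \<inter> topspace X. h x \<le> \<delta>) \<and>
     (\<forall>x\<in>B \<inter> topspace X. 1 \<le> h x) \<and> (\<forall>x\<in>topspace X. h x \<le> 1 + \<delta>)"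
  proof (intro bexI[OF _ T_funpow[OF \<open>f \<in> T\<close>, of n]] conjI ballI)
    fix x assume x: "x \<in> A \<inter> topspace X"
    then have "(\<phi> ^^ n) (f x) \<le> (\<phi> ^^ n) (max 0 q)"
      using assms(3) T_nonneg[OF \<open>f \<in> T\<close>] by (intro funpow_mono) (auto simp: le_max_iff_disj)
    with n show "(\<phi> ^^ n) (f x) \<le> \<delta>"
      by simp
  next
    fix x assume "x \<in> B \<inter> topspace X"
    then show "1 \<le> (\<phi> ^^ n) (f x)"
      using assms(4) by (auto intro: funpow_ge_1)
  next
    fix x assume x: "x \<in> topspace X"
    then have "(\<phi> ^^ n) (f x) \<le> (\<phi> ^^ n) (max 1 M)"
      using M T_nonneg[OF \<open>f \<in> T\<close>] by (intro funpow_mono) (auto simp: le_max_iff_disj)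
    with n show "(\<phi> ^^ n) (f x) \<le> 1 + \<delta>"
      by simp
  qed
qed

text \<open>In the average, a point of either set gets at most 1/4 from one function and at most 5/4
  from the other, hence at most 3/4. The iteration in \<open>separatedI\<close> turns this gap back
  into an arbitrary \<delta>.\<close>

lemma separated_Un_left:
  assumes "separated A B" "separated A' B"
  shows "separated (A \<union> A') B"
proof -
  obtain h where h: "h \<in> T" "\<And>x. x \<in> A \<Longrightarrow> x \<in> topspace X \<Longrightarrow> h x \<le> 1/4"
    "\<And>x. x \<in> B \<Longrightarrow> x \<in> topspace X \<Longrightarrow> 1 \<le> h x" "\<And>x. x \<in> topspace X \<Longrightarrow> h x \<le> 1 + 1/4"
    by (rule separatedD[OF assms(1), of "1/4"]) auto
  obtain h' where h': "h' \<in> T" "\<And>x. x \<in> A' \<Longrightarrow> x \<in> topspace X \<Longrightarrow> h' x \<le> 1/4"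
    "\<And>x. x \<in> B \<Longrightarrow> x \<in> topspace X \<Longrightarrow> 1 \<le> h' x" "\<And>x. x \<in> topspace X \<Longrightarrow> h' x \<le> 1 + 1/4"
    by (rule separatedD[OF assms(2), of "1/4"]) auto
  have "(\<lambda>x. 1/2 * (h x + h' x)) \<in> T"
    using T_scale[OF _ T_add[OF h(1) h'(1)], of "1/2"] by simp
  then show ?thesis
  proof (rule separatedI[where q = "3/4"])
    show "1/2 * (h x + h' x) \<le> 3/4" if "x \<in> A \<union> A'" "x \<in> topspace X" for x
      using that h(2,4)[of x] h'(2,4)[of x] by auto
    show "1 \<le> 1/2 * (h x + h' x)" if "x \<in> B" "x \<in> topspace X" for x
      using that h(3)[of x] h'(3)[of x] by auto
  qed simp
qed

text \<open>At a point of \<open>B\<close> or \<open>B'\<close> one summand is at least 1 and the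
  other nonnegative, while on \<open>A\<close> the sum is at most 1/2. Values of the sum far above 1
  are corrected by \<open>separatedI\<close>.\<close>

lemma separated_Un_right:
  assumes "separated A B" "separated A B'"
  shows "separated A (B \<union> B')"
proof -
  obtain h where h: "h \<in> T" "\<And>x. x \<in> A \<Longrightarrow> x \<in> topspace X \<Longrightarrow> h x \<le> 1/4"
    "\<And>x. x \<in> B \<Longrightarrow> x \<in> topspace X \<Longrightarrow> 1 \<le> h x"
    by (rule separatedD[OF assms(1), of "1/4"]) auto
  obtain h' where h': "h' \<in> T" "\<And>x. x \<in> A \<Longrightarrow> x \<in> topspace X \<Longrightarrow> h' x \<le> 1/4"
    "\<And>x. x \<in> B' \<Longrightarrow> x \<in> topspace X \<Longrightarrow> 1 \<le> h' x"
    by (rule separatedD[OF assms(2), of "1/4"]) auto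
  show ?thesis
  proof (rule separatedI[OF T_add[OF h(1) h'(1)], where q = "1/2"])
    show "h x + h' x \<le> 1/2" if "x \<in> A" "x \<in> topspace X" for x
      using that h(2)[of x] h'(2)[of x] by auto
    show "1 \<le> h x + h' x" if "x \<in> B \<union> B'" "x \<in> topspace X" for x
      using that h(3)[of x] h'(3)[of x] T_nonneg[OF h(1), of x] T_nonneg[OF h'(1), of x] by auto
  qed simp
qed

text \<open>The cone admits only positive factors, so the zero function may be missing; a small
  multiple of any element of \<open>T\<close> serves instead.\<close>

lemma separated_empty_right: "separated A {}"
proof -
  obtain f where "f \<in> T"
    using T_nonempty by blast
  obtain M where M: "0 < M" "\<And>x. x \<in> topspace X \<Longrightarrow> f x \<le> M"
    using bounded_above continuous \<open>f \<in> T\<close> by metis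
  have "(\<lambda>x. 1 / (2 * M) * f x) \<in> T"
    using \<open>f \<in> T\<close> M(1) by (intro T_scale) auto
  then show ?thesis
    by (rule separatedI[where q = "1/2"]) (use M in \<open>auto simp: field_simps\<close>)
qed

lemma separated_level_sets:
  assumes "f \<in> T" "0 \<le> c" "c < d"
  shows "separated {x \<in> topspace X. f x \<le> c} {x \<in> topspace X. d \<le> f x}"
proof -
  have "(\<lambda>x. 1 / d * f x) \<in> T"
    using assms by (intro T_scale) auto
  then show ?thesis
    by (rule separatedI[where q = "c / d"]) (use assms in \<open>auto simp: field_simps\<close>)
qed

lemma separated_points:
  assumes "f \<in> T" "y \<in> topspace X" "x \<in> topspace X" "f y < f x"
  obtains U V where "openin X U" "openin X V" "x \<in> U" "y \<in> V" "separated V U"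
proof -
  obtain c where c: "f y < c" "c < f x"
    using assms dense by blast
  then obtain d where d: "c < d" "d < f x"
    using dense by blast
  have "0 \<le> c"
    using c T_nonneg[OF assms(1,2)] by simp
  let ?U = "{x \<in> topspace X. f x \<in> {d<..}}" and ?V = "{x \<in> topspace X. f x \<in> {..<c}}"
  have "openin X ?U" "openin X ?V"
    by (intro openin_continuous_map_preimage[OF continuous[OF \<open>f \<in> T\<close>]]; simp)+
  moreover have "separated ?V ?U"
    by (rule separated_mono[OF separated_level_sets[OF \<open>f \<in> T\<close> \<open>0 \<le> c\<close> d(1)]]) auto
  ultimately show thesis
    using that[of ?U ?V] assms c d by auto
qed

text \<open>The outer induction needs, for each point \<open>x\<close> of \<open>B\<close>, a
  neighbourhood separated from all of \<open>A\<close>. The inner induction over \<open>A\<close>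
  builds it, intersecting the neighbourhoods of \<open>x\<close> found for the pieces of
  \<open>A\<close>.\<close>

lemma separated_compact:
  assumes "compactin X A" "compactin X B"
    and pos: "\<And>x. x \<in> B \<Longrightarrow> \<exists>f\<in>T. 0 < f x"
    and less: "\<And>x y. x \<in> B \<Longrightarrow> y \<in> A \<Longrightarrow> \<exists>f\<in>T. f y < f x"
  shows "separated A B"
  using \<open>compactin X B\<close>
proof (induction rule: compactin_induct)
  case (local x)
  then have x: "x \<in> topspace X"
    using assms compactin_subset_topspace by blast
  from \<open>compactin X A\<close> show ?case
  proof (induction rule: compactin_induct)
    case (local y)
    then have "y \<in> topspace X"
      using assms compactin_subset_topspace by blast
    moreover obtain f where "f \<in> T" "f y < f x"
      using less \<open>x \<in> B\<close> local by blast
    ultimately obtain U V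
      where "openin X U" "openin X V" "x \<in> U" "y \<in> V" "separated V U"
      using separated_points x by metis
    then show ?case
      by blast
  next
    \<comment> \<open>There is no point to which \<open>less\<close> could apply; \<open>pos\<close>
      supplies a function that stays above half its value at \<open>x\<close> on a neighbourhood of
      \<open>x\<close>.\<close>
    case empty
    obtain f where f: "f \<in> T" "0 < f x"
      using pos \<open>x \<in> B\<close> by blast
    let ?U = "{z \<in> topspace X. f z \<in> {f x / 2<..}}"
    have "openin X ?U"
      by (intro openin_continuous_map_preimage[OF continuous[OF \<open>f \<in> T\<close>]]) simp
    moreover have "separated {} ?U"
      by (rule separated_mono[OF separated_level_sets[OF \<open>f \<in> T\<close>, of 0 "f x / 2"]]) (use f in auto)
    ultimately show ?case
      using x f by (intro exI[of _ ?U]) auto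
  next
    case (Un C D)
    then obtain U V where "openin X U" "x \<in> U" "separated C U" "openin X V" "x \<in> V" "separated D V"
      by blast
    then show ?case
      by (intro exI[of _ "U \<inter> V"] conjI separated_Un_left) (auto elim: separated_mono)
  next
    case (subset C D)
    then show ?case
      using separated_mono by blast
  qed
next
  case (subset C D)
  then show ?case
    using separated_mono by blast
qed (auto intro: separated_empty_right separated_Un_right)

section \<open>Layer sums and approximation\<close>

text \<open>The second and fourth conjuncts estimate \<open>g\<close> from both sides; the first and
  third carry the induction. A new layer adds at most \<epsilon> * \<delta> where \<open>g x\<close>
  is at most \<open>n * \<epsilon>\<close>. Above that level the first conjunct bounds the sum, and
  the third says that the lower layers are full. The induction starts at one layer because
  \<open>T\<close> need not contain the zero function.\<close>

lemma layer_sum: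
  fixes n :: nat and \<epsilon> \<delta> :: real and g :: "'a \<Rightarrow> real"
  assumes "0 < \<epsilon>" "0 < \<delta>" and g: "\<And>x. x \<in> topspace X \<Longrightarrow> 0 \<le> g x"
    and sep: "\<And>a b. 0 \<le> a \<Longrightarrow> a < b \<Longrightarrow>
      separated {x \<in> topspace X. g x \<le> a} {x \<in> topspace X. b \<le> g x}"
    and "0 < n"
  shows "\<exists>h\<in>T. \<forall>x\<in>topspace X. h x \<le> n * (\<epsilon> + \<epsilon> * \<delta>) \<and> h x \<le> g x + \<epsilon> + n * (\<epsilon> * \<delta>) \<and>
     (n * \<epsilon> \<le> g x \<longrightarrow> n * \<epsilon> \<le> h x) \<and> min (g x) (n * \<epsilon>) \<le> h x + \<epsilon>"
  using \<open>0 < n\<close>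
proof (induction n rule: nat_induct_non_zero)
  case 1
  have k_sep: "separated {x \<in> topspace X. g x \<le> 0} {x \<in> topspace X. \<epsilon> \<le> g x}"
    using assms(1) by (intro sep) auto
  obtain k where k: "k \<in> T"
    "\<And>x. x \<in> topspace X \<Longrightarrow> \<epsilon> \<le> g x \<Longrightarrow> 1 \<le> k x" "\<And>x. x \<in> topspace X \<Longrightarrow> k x \<le> 1 + \<delta>"
    by (rule separatedD[OF k_sep \<open>0 < \<delta>\<close>]) auto
  show ?case
  proof (intro bexI[OF _ T_scale[OF \<open>0 < \<epsilon>\<close> \<open>k \<in> T\<close>]] ballI)
    fix x assume x: "x \<in> topspace X"
    have "\<epsilon> * k x \<le> \<epsilon> * (1 + \<delta>)"
      using k(3)[OF x] assms(1) by (intro mult_left_mono) auto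
    moreover have "0 \<le> \<epsilon> * k x"
      using T_nonneg[OF k(1) x] assms(1) by simp
    moreover have "\<epsilon> \<le> \<epsilon> * k x" if "\<epsilon> \<le> g x"
      using k(2)[OF x that] assms(1) by simp
    ultimately show "\<epsilon> * k x \<le> real 1 * (\<epsilon> + \<epsilon> * \<delta>) \<and> \<epsilon> * k x \<le> g x + \<epsilon> + real 1 * (\<epsilon> * \<delta>) \<and>
      (real 1 * \<epsilon> \<le> g x \<longrightarrow> real 1 * \<epsilon> \<le> \<epsilon> * k x) \<and> min (g x) (real 1 * \<epsilon>) \<le> \<epsilon> * k x + \<epsilon>"
      using g[OF x] by (auto simp: algebra_simps)
  qed
next
  case (Suc n)
  then obtain h where h: "h \<in> T" "\<And>x. x \<in> topspace X \<Longrightarrow>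
     h x \<le> n * (\<epsilon> + \<epsilon> * \<delta>) \<and> h x \<le> g x + \<epsilon> + n * (\<epsilon> * \<delta>) \<and>
     (n * \<epsilon> \<le> g x \<longrightarrow> n * \<epsilon> \<le> h x) \<and> min (g x) (n * \<epsilon>) \<le> h x + \<epsilon>"
    by blast
  have k_sep: "separated {x \<in> topspace X. g x \<le> n * \<epsilon>} {x \<in> topspace X. n * \<epsilon> + \<epsilon> \<le> g x}"
    using assms(1) by (intro sep) auto
  obtain k where k: "k \<in> T"
    "\<And>x. x \<in> topspace X \<Longrightarrow> g x \<le> n * \<epsilon> \<Longrightarrow> k x \<le> \<delta>"
    "\<And>x. x \<in> topspace X \<Longrightarrow> n * \<epsilon> + \<epsilon> \<le> g x \<Longrightarrow> 1 \<le> k x"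
    "\<And>x. x \<in> topspace X \<Longrightarrow> k x \<le> 1 + \<delta>"
    by (rule separatedD[OF k_sep \<open>0 < \<delta>\<close>]) auto
  show ?case
  proof (intro bexI[OF _ T_add[OF h(1) T_scale[OF \<open>0 < \<epsilon>\<close> \<open>k \<in> T\<close>]]] ballI)
    fix x assume x: "x \<in> topspace X"
    have "\<epsilon> * k x \<le> \<epsilon> * (1 + \<delta>)"
      using k(4)[OF x] assms(1) by (intro mult_left_mono) auto
    then have 1: "\<epsilon> * k x \<le> \<epsilon> + \<epsilon> * \<delta>"
      by (simp add: algebra_simps)
    have 2: "0 \<le> \<epsilon> * k x"
      using T_nonneg[OF k(1) x] assms(1) by simp
    have 3: "\<epsilon> \<le> \<epsilon> * k x" if "n * \<epsilon> + \<epsilon> \<le> g x"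
      using k(3)[OF x that] assms(1) by simp
    have 4: "\<epsilon> * k x \<le> \<epsilon> * \<delta>" if "g x \<le> n * \<epsilon>"
      using k(2)[OF x that] assms(1) by simp
    have *: "Suc n * (\<epsilon> + \<epsilon> * \<delta>) = n * \<epsilon> + n * (\<epsilon> * \<delta>) + \<epsilon> + \<epsilon> * \<delta>"
      "Suc n * (\<epsilon> * \<delta>) = n * (\<epsilon> * \<delta>) + \<epsilon> * \<delta>" "Suc n * \<epsilon> = n * \<epsilon> + \<epsilon>"
      "n * (\<epsilon> + \<epsilon> * \<delta>) = n * \<epsilon> + n * (\<epsilon> * \<delta>)"
      by (simp_all add: algebra_simps)
    \<comment> \<open>The cases are \<open>g x\<close> at most \<open>n * \<epsilon>\<close>,
      between that and the next level, and from the next level on. In the middle one the height of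
      the new layer is uncertain, and the slack \<epsilon> in both estimates absorbs it.\<close>
    show "h x + \<epsilon> * k x \<le> Suc n * (\<epsilon> + \<epsilon> * \<delta>) \<and> h x + \<epsilon> * k x \<le> g x + \<epsilon> + Suc n * (\<epsilon> * \<delta>) \<and>
      (Suc n * \<epsilon> \<le> g x \<longrightarrow> Suc n * \<epsilon> \<le> h x + \<epsilon> * k x) \<and>
      min (g x) (Suc n * \<epsilon>) \<le> h x + \<epsilon> * k x + \<epsilon>"
      using h(2)[OF x] 1 2 3 4 assms(1) unfolding * by (smt (verit))
  qed
qed

text \<open>Preorder and zero locus enter in contrapositive form: by \<open>less\<close>,
  \<open>g\<close> is isotone for the preorder generated by \<open>T\<close>, and by
  \<open>pos\<close> it vanishes wherever all of \<open>T\<close> does.\<close>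

lemma approximation:
  assumes g: "continuous_map X euclideanreal g" "\<And>x. x \<in> topspace X \<Longrightarrow> 0 \<le> g x"
    and pos: "\<And>x. x \<in> topspace X \<Longrightarrow> 0 < g x \<Longrightarrow> \<exists>f\<in>T. 0 < f x"
    and less: "\<And>x y. x \<in> topspace X \<Longrightarrow> y \<in> topspace X \<Longrightarrow> g y < g x \<Longrightarrow> \<exists>f\<in>T. f y < f x"
    and "0 < e"
  shows "\<exists>h\<in>T. \<forall>x\<in>topspace X. \<bar>g x - h x\<bar> \<le> e"
proof -
  have sep: "separated {x \<in> topspace X. g x \<le> a} {x \<in> topspace X. b \<le> g x}"
    if "0 \<le> a" "a < b" for a b
  proof (rule separated_compact)
    have "closedin X {x \<in> topspace X. g x \<in> {..a}}" "closedin X {x \<in> topspace X. g x \<in> {b..}}"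
      by (intro closedin_continuous_map_preimage[OF g(1)]; simp)+
    then show "compactin X {x \<in> topspace X. g x \<le> a}" "compactin X {x \<in> topspace X. b \<le> g x}"
      using closedin_compact_space[OF compact] by simp_all
  qed (use that in \<open>auto intro: pos less\<close>)
  obtain M where M: "0 < M" "\<And>x. x \<in> topspace X \<Longrightarrow> g x \<le> M"
    using bounded_above g(1) by metis
  obtain n :: nat where "0 < n" and n: "M < n * (e / 2)"
  proof -
    obtain n :: nat where "M < n * (e / 2)"
      using reals_Archimedean3[of "e / 2"] \<open>0 < e\<close> by auto
    moreover from this have "0 < n"
      using M(1) by (intro gr0I) auto
    ultimately show thesis
      using that by blast
  qed
  \<comment> \<open>The top level \<open>n * \<epsilon>\<close> equals \<open>M\<close>, so the
    truncation \<open>min (g x) M\<close> is \<open>g x\<close> itself. The choice of \<delta> makes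
    the errors of all \<open>n\<close> layers add up to \<open>e / 2\<close>, and that of
    \<open>n\<close> makes \<epsilon> at most \<open>e / 2\<close>.\<close>
  define \<epsilon> where "\<epsilon> = M / n"
  define \<delta> where "\<delta> = e / (2 * M)"
  have "0 < \<epsilon>" "0 < \<delta>" "n * \<epsilon> = M" "\<epsilon> \<le> e / 2" "n * (\<epsilon> * \<delta>) = e / 2"
    using \<open>0 < n\<close> n M(1) \<open>0 < e\<close> by (simp_all add: \<epsilon>_def \<delta>_def field_simps)
  with layer_sum[of \<epsilon> \<delta> g n, OF _ _ g(2) sep \<open>0 < n\<close>] obtain h where "h \<in> T"
    and h: "\<And>x. x \<in> topspace X \<Longrightarrow> h x \<le> g x + \<epsilon> + e / 2 \<and> min (g x) M \<le> h x + \<epsilon>"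
    by auto
  show ?thesis
  proof (intro bexI[OF _ \<open>h \<in> T\<close>] ballI)
    fix x assume "x \<in> topspace X"
    with h M(2) \<open>\<epsilon> \<le> e / 2\<close> \<open>0 < e\<close> show "\<bar>g x - h x\<bar> \<le> e"
      by (smt (verit) field_sum_of_halves)
  qed
qed

end

section \<open>Uniform closure as pointwise approximation\<close>

lemma in_uniform_closure_iff:
  assumes "S \<subseteq> C_space X"
  shows "f \<in> uniform_closure X S \<longleftrightarrow>
    f \<in> C_space X \<and> (\<forall>e>0. \<exists>g\<in>S. \<forall>x\<in>topspace X. \<bar>f x - g x\<bar> \<le> e)"
proof -
  interpret M: Metric_space "C_space X" "mdist (C_metric X)"
    by (rule Metric_space_mspace_mdist)
  \<comment> \<open>A pointwise bound gives only a weak inequality for the supremum, while open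
    balls need a strict one; hence the half.\<close>
  have dist: "mdist (C_metric X) f g < e" if "f \<in> C_space X" "g \<in> S" "0 < e"
      "\<forall>x\<in>topspace X. \<bar>f x - g x\<bar> \<le> e / 2" for f g e
    using mdist_cfunspace_le[of "e / 2" X euclidean_metric f g] that by (simp add: dist_real_def)
  have "(\<forall>e>0. \<exists>g\<in>S. mdist (C_metric X) f g < e) \<longleftrightarrow>
      (\<forall>e>0. \<exists>g\<in>S. \<forall>x\<in>topspace X. \<bar>f x - g x\<bar> \<le> e)" (is "?L \<longleftrightarrow> ?R") if f: "f \<in> C_space X"
  proof
    assume ?L
    show ?R
    proof (intro allI impI)
      fix e :: real assume "0 < e"
      with \<open>?L\<close> obtain g where "g \<in> S" "mdist (C_metric X) f g < e"
        by blast
      then show "\<exists>g\<in>S. \<forall>x\<in>topspace X. \<bar>f x - g x\<bar> \<le> e"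
        using mdist_cfunspace_imp_mdist_le[OF f, of g e] assms
        by (intro bexI[of _ g]) (auto simp: dist_real_def)
    qed
  next
    assume ?R
    then show ?L
      using dist[OF f] by (meson half_gt_zero)
  qed
  moreover have "f \<in> uniform_closure X S \<longleftrightarrow>
      f \<in> C_space X \<and> (\<forall>e>0. \<exists>g\<in>S. mdist (C_metric X) f g < e)"
    using assms unfolding mtopology_of_def M.metric_closure_of M.in_mball by blast
  ultimately show ?thesis
    by blast
qed

text \<open>Nonnegativity, isotony and vanishing are weak inequalities between values at one or two
  points, so they survive approximation. Since approximation is known on \<open>topspace X\<close>
  only, the pairs in \<open>r\<close> have to lie there.\<close>

lemma uniform_closure_subset_C_plus_vanishing:
  assumes "S \<subseteq> C_plus X r" "r \<subseteq> topspace X \<times> topspace X"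
  shows "uniform_closure X S \<subseteq> C_plus_vanishing X r (zero_locus X S)"
proof
  fix f assume "f \<in> uniform_closure X S"
  moreover have S: "S \<subseteq> C_space X"
    using assms(1) unfolding C_plus_def by blast
  ultimately have "f \<in> C_space X"
    and f: "\<And>e. 0 < e \<Longrightarrow> \<exists>g\<in>S. \<forall>x\<in>topspace X. \<bar>f x - g x\<bar> \<le> e"
    unfolding in_uniform_closure_iff[OF S] by auto
  have "f x \<le> f y" if "(x, y) \<in> r" for x y
  proof (rule field_le_epsilon)
    fix e :: real assume "0 < e"
    with f[of "e / 2"] obtain g where "g \<in> S" "\<forall>x\<in>topspace X. \<bar>f x - g x\<bar> \<le> e / 2"
      by auto
    moreover have "x \<in> topspace X" "y \<in> topspace X"
      using that assms(2) by auto
    ultimately have "\<bar>f x - g x\<bar> \<le> e / 2" "\<bar>f y - g y\<bar> \<le> e / 2"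
      by auto
    moreover have "g x \<le> g y"
      using \<open>g \<in> S\<close> that assms(1) by (auto simp: C_plus_def isotone_def)
    ultimately show "f x \<le> f y + e"
      by linarith
  qed
  moreover have "0 \<le> f x" if x: "x \<in> topspace X" for x
  proof (rule field_le_epsilon)
    fix e :: real assume "0 < e"
    with f[of e] obtain g where "g \<in> S" "\<bar>f x - g x\<bar> \<le> e"
      using x by auto
    moreover have "0 \<le> g x"
      using \<open>g \<in> S\<close> x assms(1) by (auto simp: C_plus_def)
    ultimately show "0 \<le> f x + e"
      by linarith
  qed
  moreover have "f x = 0" if x: "x \<in> zero_locus X S" for x
  proof -
    have "\<bar>f x\<bar> \<le> 0"
    proof (rule field_le_epsilon)
      fix e :: real assume "0 < e"
      with f[of e] obtain g where "g \<in> S" "\<bar>f x - g x\<bar> \<le> e"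
        using x by (auto simp: zero_locus_def)
      moreover have "g x = 0"
        using \<open>g \<in> S\<close> x by (auto simp: zero_locus_def)
      ultimately show "\<bar>f x\<bar> \<le> 0 + e"
        by simp
    qed
    then show ?thesis
      by simp
  qed
  ultimately show "f \<in> C_plus_vanishing X r (zero_locus X S)"
    using \<open>f \<in> C_space X\<close> unfolding C_plus_vanishing_def C_plus_def isotone_def by blast
qed

section \<open>Passage between the cone \<open>S\<close> and its non-extensional version\<close>

theorem theorem1p3:
  fixes X :: "'a topology" and r :: "'a rel"
    and \<phi> :: "real \<Rightarrow> real" and S :: "('a \<Rightarrow> real) set"
  assumes "compact_preordered_space X r"
    and "\<forall>t \<ge> 0. 0 \<le> \<phi> t"
    and "mono_on {0..} \<phi>"
    and "continuous_on {0..} \<phi>"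
    and "\<forall>t \<ge> 0. \<phi> t \<le> t"
    and "\<forall>t \<ge> 0. \<phi> t = t \<longleftrightarrow> t = 0 \<or> t = 1"
    and "S \<subseteq> C_plus X r"
    and "S \<noteq> {}"
    and "convex_cone_on X S"
    and "\<forall>f \<in> S. (\<lambda>x \<in> topspace X. \<phi> (f x)) \<in> S"
    and "r = generated_preorder X S"
  shows "uniform_closure X S = C_plus_vanishing X r (zero_locus X S)
    \<and> (zero_locus X S = {} \<longleftrightarrow> (\<forall>x \<in> topspace X. \<exists>f \<in> S. f x > 0))
    \<and> ((\<lambda>x \<in> topspace X. 1) \<in> S \<longrightarrow> zero_locus X S = {})
    \<and> (zero_locus X S = {} \<longrightarrow> uniform_closure X S = C_plus X r)"
proof -
  have ts: "r \<subseteq> topspace X \<times> topspace X"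
    using assms(11) by (auto simp: generated_preorder_def)
  have S_C: "S \<subseteq> C_space X"
    using assms(7) unfolding C_plus_def by blast
  have S_nonneg: "0 \<le> f x" if "f \<in> S" "x \<in> topspace X" for f x
    using that assms(7) by (auto simp: C_plus_def)
  \<comment> \<open>Dropping extensionality makes the hypotheses on \<open>S\<close> plain closure under pointwise operations.\<close>
  define T where "T = {f. restrict f (topspace X) \<in> S}"
  have S_T: "f \<in> T" if "f \<in> S" for f
    using that S_C by (auto simp: T_def extensional_restrict)
  interpret contracted_cone \<phi> X T
  proof
    fix f g :: "'a \<Rightarrow> real" and c :: real
    assume f: "f \<in> T"
    then have "continuous_map X euclideanreal (restrict f (topspace X))"
      using S_C by (auto simp: T_def)
    then show "continuous_map X euclideanreal f"
      by (rule continuous_map_eq) simp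
    show "0 \<le> f x" if "x \<in> topspace X" for x
      using f S_nonneg that by (fastforce simp: T_def)
    show "(\<lambda>x. f x + g x) \<in> T" if "g \<in> T"
    proof -
      \<comment> \<open>Closure of \<open>S\<close> applies to the restricted summands; the inner
        restrictions then disappear under the outer one by \<open>restrict_cong\<close>.\<close>
      have "(\<lambda>x\<in>topspace X. restrict f (topspace X) x + restrict g (topspace X) x) \<in> S"
        using f that assms(9) by (simp only: T_def convex_cone_on_def mem_Collect_eq)
      then show ?thesis
        by (simp add: T_def cong: restrict_cong)
    qed
    show "(\<lambda>x. c * f x) \<in> T" if "0 < c"
    proof -
      have "(\<lambda>x\<in>topspace X. c * restrict f (topspace X) x) \<in> S"
        using f that assms(9) by (simp only: T_def convex_cone_on_def mem_Collect_eq)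
      then show ?thesis
        by (simp add: T_def cong: restrict_cong)
    qed
    show "(\<lambda>x. \<phi> (f x)) \<in> T"
    proof -
      have "(\<lambda>x\<in>topspace X. \<phi> (restrict f (topspace X) x)) \<in> S"
        using f assms(10) by (simp only: T_def mem_Collect_eq)
      then show ?thesis
        by (simp add: T_def cong: restrict_cong)
    qed
  qed (use assms S_T in \<open>auto simp: compact_preordered_space_def\<close>)
  have "C_plus_vanishing X r (zero_locus X S) \<subseteq> uniform_closure X S"
  proof
    fix g assume "g \<in> C_plus_vanishing X r (zero_locus X S)"
    then have g: "g \<in> C_space X" "\<And>x. x \<in> topspace X \<Longrightarrow> 0 \<le> g x"
      "\<And>x y. (x, y) \<in> r \<Longrightarrow> g x \<le> g y" "\<And>x. x \<in> zero_locus X S \<Longrightarrow> g x = 0"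
      by (auto simp: C_plus_vanishing_def C_plus_def isotone_def)
    have "\<exists>h\<in>S. \<forall>x\<in>topspace X. \<bar>g x - h x\<bar> \<le> e" if "0 < e" for e
    proof -
      have "\<exists>h\<in>T. \<forall>x\<in>topspace X. \<bar>g x - h x\<bar> \<le> e"
      proof (rule approximation)
        show "continuous_map X euclideanreal g"
          using g(1) by simp
        show "\<exists>f\<in>T. 0 < f x" if x: "x \<in> topspace X" "0 < g x" for x
        proof -
          have "x \<notin> zero_locus X S"
            using g(4) x by auto
          then obtain f where "f \<in> S" "f x \<noteq> 0"
            using x by (auto simp: zero_locus_def)
          then show ?thesis
            using S_T S_nonneg x by (metis order_le_less)
        qed
        show "\<exists>f\<in>T. f y < f x" if "x \<in> topspace X" "y \<in> topspace X" "g y < g x" for x y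
        proof -
          \<comment> \<open>Isotonicity of \<open>g\<close> excludes the pair from \<open>r\<close>;
            as \<open>r\<close> is generated by \<open>S\<close>, some element of \<open>S\<close>
            is strictly larger at \<open>x\<close> than at \<open>y\<close>.\<close>
          have "(x, y) \<notin> r"
            using g(3) that by force
          then show ?thesis
            using that S_T unfolding assms(11) generated_preorder_def by (auto simp: not_le)
        qed
      qed (use g(2) \<open>0 < e\<close> in auto)
      then obtain h where "h \<in> T" "\<forall>x\<in>topspace X. \<bar>g x - h x\<bar> \<le> e"
        by blast
      then show ?thesis
        by (intro bexI[of _ "restrict h (topspace X)"]) (auto simp: T_def)
    qed
    then show "g \<in> uniform_closure X S"
      unfolding in_uniform_closure_iff[OF S_C] using g(1) by blast
  qed
  then have closure: "uniform_closure X S = C_plus_vanishing X r (zero_locus X S)"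
    using uniform_closure_subset_C_plus_vanishing[OF assms(7) ts] by blast
  moreover have zero: "zero_locus X S = {} \<longleftrightarrow> (\<forall>x\<in>topspace X. \<exists>f\<in>S. f x > 0)"
    using S_nonneg unfolding zero_locus_def by (force simp: order_less_le)
  moreover have "zero_locus X S = {}" if "(\<lambda>x\<in>topspace X. 1) \<in> S"
    unfolding zero using that by (auto intro!: bexI[OF _ that])
  moreover have "uniform_closure X S = C_plus X r" if "zero_locus X S = {}"
    unfolding closure that by (simp add: C_plus_vanishing_def)
  ultimately show ?thesis
    by blast
qed

end
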